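(* Let $p\in(1,\infty)$. The following assertions hold. (i) $\mathscr{M}(d_p)\subsetneq d_p$. (ii) $\mathscr{M}(d_p)\neq\ell^1$.
   Context: Let $\mathbb{N}_0=\{0,1,2,\dots\}$ and $\ell^1=\ell^1(\mathbb{N}_0)$ (complex sequences). For $p\in[1,\infty)$, $d_p$ is the Banach space of all complex sequences $a=(a_n)_{n=0}^\infty$ with $\|a\|_{d_p}:=\big(\sum_{n=0}^\infty\sup_{k\ge n}|a_k|^p\big)^{1/p}<\infty$. The convolution of $a,b\in\mathbb{C}^{\mathbb{N}_0}$ is $(a*b)_n:=\sum_{j=0}^n a_jb_{n-j}$, $n\in\mathbb{N}_0$. The multiplier algebra of $d_p$ is $\mathscr{M}(d_p):=\{b\in\mathbb{C}^{\mathbb{N}_0}: a*b\in d_p \text{ for all } a\in d_p\}$. *)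

theory Defs
  imports "HOL-Analysis.Analysis"
begin

definition ell1 :: "(nat \<Rightarrow> complex) set" where
  "ell1 = {a. summable (\<lambda>n. cmod (a n))}"

(* All suprema and sums are taken in [0,\<infinity>], so that unbounded sequences and divergent
   series are given the value \<infinity> (and not a default real number). *)
definition dp_sum :: "real \<Rightarrow> (nat \<Rightarrow> complex) \<Rightarrow> ennreal" where
  "dp_sum p a = (\<Sum>n. SUP k\<in>{n..}. ennreal (cmod (a k) powr p))"

(* The p-th root of dp_sum in [0,\<infinity>]; powr is not available on ennreal. *)
definition dp_norm :: "real \<Rightarrow> (nat \<Rightarrow> complex) \<Rightarrow> ennreal" where
  "dp_norm p a =
     (if dp_sum p a = \<infinity> then \<infinity> else ennreal (enn2real (dp_sum p a) powr (1 / p)))"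

definition dp_space :: "real \<Rightarrow> (nat \<Rightarrow> complex) set" where
  "dp_space p = {a. dp_norm p a < \<infinity>}"

definition convolution :: "(nat \<Rightarrow> complex) \<Rightarrow> (nat \<Rightarrow> complex) \<Rightarrow> nat \<Rightarrow> complex" where
  "convolution a b n = (\<Sum>j\<le>n. a j * b (n - j))"

definition multipliers :: "(nat \<Rightarrow> complex) set \<Rightarrow> (nat \<Rightarrow> complex) set" where
  "multipliers X = {b. \<forall>a\<in>X. convolution a b \<in> X}"

end

theory Submission
  imports Defs
begin

text \<open>
  Convolving with the unit sequence \<open>(1, 0, 0, \<dots>)\<close>, which lies in $d_p$, shows that every
  multiplier lies in $d_p$. Two explicit sequences then settle both claims.

  For strictness, power sequences suffice. Put \<open>s = (1 + 1/p)/2\<close> and \<open>a\<^sub>n = (n + 1)\<^sup>-\<^sup>s\<close>. The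
  sequence \<open>a\<close> decreases and \<open>s p = (p + 1)/2 > 1\<close>, so \<open>a\<close> lies in $d_p$. All \<open>n + 1\<close> terms of
  the \<open>n\<close>-th entry of the convolution square of \<open>a\<close> are at least \<open>(n + 1)\<close> to the power \<open>-2s\<close>, so
  the entry is at least \<open>(n + 1)\<close> to the power \<open>1 - 2s = -1/p\<close>, and its \<open>p\<close>-th power dominates the
  harmonic series. Hence \<open>a\<close> is not a multiplier.

  For the second claim, membership in $d_p$ depends on the least decreasing majorant of a sequence,
  which may be much larger than the sequence itself if the support is sparse. The sequence that
  equals \<open>m\<close> to the power \<open>-1/p\<close> at the powers of two \<open>m\<close>, and vanishes elsewhere, is summable as
  a geometric series, but the \<open>p\<close>-th power of its decreasing majorant is at least \<open>1/(2(n + 1))\<close>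
  at \<open>n\<close>. So it lies in \<open>ell1\<close> but not in $d_p$, and a fortiori is not a multiplier.
\<close>

lemma mem_dp_space_iff: "a \<in> dp_space p \<longleftrightarrow> dp_sum p a \<noteq> \<infinity>"
  by (simp add: dp_space_def dp_norm_def)

text \<open>
  The sum defining the norm runs over the least decreasing majorant of \<open>cmod (a k) powr p\<close>. The next
  two lemmas compare that majorant with a real series from above and from below, so that suprema and
  sums in \<open>ennreal\<close> do not occur afterwards.
\<close>

lemma dp_spaceI:
  assumes "summable f" and bound: "\<And>n k. n \<le> k \<Longrightarrow> cmod (a k) powr p \<le> f n"
  shows "a \<in> dp_space p"
proof -
  have nonneg: "0 \<le> f n" for n
    using bound[of n n] by (meson order_trans powr_ge_zero order_refl)
  have "dp_sum p a \<le> (\<Sum>n. ennreal (f n))"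
    unfolding dp_sum_def
    by (intro suminf_le SUP_least ennreal_leI bound) auto
  also have "\<dots> < \<infinity>"
    using assms(1) nonneg by (simp add: suminf_ennreal2)
  finally show ?thesis
    by (simp add: mem_dp_space_iff)
qed

lemma not_mem_dp_spaceI:
  assumes "\<not> summable f" and nonneg: "\<And>n. 0 \<le> f n"
    and bound: "\<And>n. \<exists>k\<ge>n. f n \<le> cmod (a k) powr p"
  shows "a \<notin> dp_space p"
proof
  assume "a \<in> dp_space p"
  have "(\<Sum>n. ennreal (f n)) \<le> dp_sum p a"
    unfolding dp_sum_def
  proof (intro suminf_le)
    fix n
    obtain k where "n \<le> k" "f n \<le> cmod (a k) powr p"
      using bound by blast
    then show "ennreal (f n) \<le> (SUP k\<in>{n..}. ennreal (cmod (a k) powr p))"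
      by (intro SUP_upper2[of k] ennreal_leI) auto
  qed auto
  with \<open>a \<in> dp_space p\<close> have "(\<Sum>n. ennreal (f n)) \<noteq> \<infinity>"
    by (auto simp: mem_dp_space_iff top_unique)
  then have "summable f"
    by (intro summable_suminf_not_top) (use nonneg in auto)
  with assms(1) show False ..
qed

lemma not_summable_inverse_Suc: "\<not> summable (\<lambda>n. 1 / real (Suc n))"
  using not_summable_harmonic[where 'a = real]
  by (subst (asm) summable_Suc_iff[symmetric]) (simp add: inverse_eq_divide)

lemma multipliers_subset_dp_space: "multipliers (dp_space p) \<subseteq> dp_space p"
proof
  fix b assume b: "b \<in> multipliers (dp_space p)"
  define e :: "nat \<Rightarrow> complex" where "e = (\<lambda>n. if n = 0 then 1 else 0)"
  have "e \<in> dp_space p"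
    by (rule dp_spaceI[of "\<lambda>n. if n = 0 then 1 else 0"]) (auto simp: e_def)
  moreover have "convolution e b = b"
  proof
    fix n
    have "convolution e b n = (\<Sum>j\<le>n. if j = 0 then b n else 0)"
      unfolding convolution_def e_def by (intro sum.cong) auto
    then show "convolution e b n = b n"
      by simp
  qed
  ultimately show "b \<in> dp_space p"
    using b by (auto simp: multipliers_def)
qed

text \<open>
  Convolution squaring turns decay of order \<open>s\<close> into decay of order \<open>2s - 1\<close>, which is slower when
  \<open>s < 1\<close>. Since \<open>p > 1\<close>, some \<open>s\<close> has \<open>1/p\<close> below \<open>s\<close> but \<open>2s - 1\<close> not above \<open>1/p\<close>, so that
  squaring leads out of the space.
\<close>

lemma dp_space_not_subset_multipliers:
  assumes "1 < p"
  shows "\<exists>a. a \<in> dp_space p \<and> a \<notin> multipliers (dp_space p)"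
proof -
  \<comment> \<open>\<open>s\<close> is the largest exponent for which the lower bound on the convolution square below still
    yields a divergent series.\<close>
  define s where "s = (1 + 1 / p) / 2"
  define r where "r = (\<lambda>n. real (Suc n) powr - s)"
  define a where "a = (\<lambda>n. complex_of_real (r n))"
  have s: "0 < s" "1 < s * p" "(1 - 2 * s) * p = - 1"
    using assms by (auto simp: s_def field_simps)
  have r_antimono: "r n \<le> r k" if "k \<le> n" for k n
    using that s(1) unfolding r_def by (intro powr_mono2') auto
  have cmod_a: "cmod (a n) = r n" for n
    by (simp add: a_def r_def)
  have "a \<in> dp_space p"
  proof (rule dp_spaceI)
    have "summable (\<lambda>n. real n powr - (s * p))"
      using s(2) by (simp add: summable_real_powr_iff)
    then show "summable (\<lambda>n. r n powr p)"
      unfolding r_def powr_powr by (subst (asm) summable_Suc_iff[symmetric]) simp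
    show "cmod (a k) powr p \<le> r n powr p" if "n \<le> k" for n k
      unfolding cmod_a using assms r_antimono[OF that]
      by (intro powr_mono2) (auto simp: r_def)
  qed
  moreover have "convolution a a \<notin> dp_space p"
  proof (rule not_mem_dp_spaceI[OF not_summable_inverse_Suc])
    fix n
    have "real (Suc n) powr (1 - 2 * s) = real (Suc n) * (r n * r n)"
      by (simp add: r_def powr_diff powr_minus powr_add[symmetric] field_simps)
    also have "\<dots> = (\<Sum>j\<le>n. r n * r n)"
      by simp
    also have "\<dots> \<le> (\<Sum>j\<le>n. r j * r (n - j))"
      by (intro sum_mono mult_mono r_antimono) (auto simp: r_def)
    also have "\<dots> = cmod (convolution a a n)"
    proof -
      have "convolution a a n = of_real (\<Sum>j\<le>n. r j * r (n - j))"
        by (simp add: convolution_def a_def)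
      moreover have "0 \<le> (\<Sum>j\<le>n. r j * r (n - j))"
        by (intro sum_nonneg) (auto simp: r_def)
      ultimately show ?thesis
        by (simp only: norm_of_real abs_of_nonneg)
    qed
    finally have "(real (Suc n) powr (1 - 2 * s)) powr p \<le> cmod (convolution a a n) powr p"
      using assms by (intro powr_mono2) auto
    then have "1 / real (Suc n) \<le> cmod (convolution a a n) powr p"
      by (simp only: powr_powr s(3)) (simp add: powr_minus_divide)
    then show "\<exists>k\<ge>n. 1 / real (Suc n) \<le> cmod (convolution a a k) powr p"
      by blast
  qed auto
  ultimately show ?thesis
    by (auto simp: multipliers_def)
qed

text \<open>
  An entry at position \<open>m\<close> also counts for all earlier positions in the norm of $d_p$, but only once
  in \<open>ell1\<close>; hence sparse sequences separate the two spaces.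
\<close>

lemma ell1_not_subset_dp_space:
  assumes "0 < p"
  shows "\<exists>b. b \<in> ell1 \<and> b \<notin> dp_space p"
proof -
  define pow2 :: "nat \<Rightarrow> nat" where "pow2 = (\<lambda>k. 2 ^ k)"
  define b where
    "b = (\<lambda>m. if m \<in> range pow2 then complex_of_real (real m powr - (1 / p)) else 0)"
  have cmod_b: "cmod (b (pow2 k)) = (2 powr - (1 / p)) ^ k" for k
  proof -
    have "real (pow2 k) = 2 powr real k"
      by (simp add: pow2_def powr_realpow)
    then have "cmod (b (pow2 k)) = 2 powr (real k * - (1 / p))"
      by (simp add: b_def powr_powr)
    also have "\<dots> = (2 powr - (1 / p)) ^ k"
      by (subst powr_realpow[symmetric]) (auto simp: powr_powr mult.commute)
    finally show ?thesis .
  qed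
  have "summable (\<lambda>k. cmod (b (pow2 k)))"
  proof -
    have "(2::real) powr - (1 / p) < 2 powr 0"
      using assms by (intro powr_less_mono) auto
    then show ?thesis
      unfolding cmod_b by (intro summable_geometric) auto
  qed
  moreover have "strict_mono pow2"
    by (auto simp: pow2_def strict_mono_def)
  ultimately have "summable (\<lambda>m. cmod (b m))"
    by (subst (asm) summable_mono_reindex) (auto simp: b_def)
  then have "b \<in> ell1"
    by (simp add: ell1_def)
  moreover have "b \<notin> dp_space p"
  proof (rule not_mem_dp_spaceI)
    show "\<not> summable (\<lambda>n. 1 / 2 * (1 / real (Suc n)))"
      using not_summable_inverse_Suc by (subst summable_cmult_iff) auto
    fix n
    \<comment> \<open>The least power of two above \<open>n + 1\<close> is at most \<open>2(n + 1)\<close>, and the entry there bounds the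
      decreasing majorant at \<open>n\<close> from below.\<close>
    obtain j where j: "2 ^ j \<le> Suc n" "Suc n < 2 ^ (j + 1)"
      using ex_power_ivl1[of 2 "Suc n"] by auto
    have "real (2 ^ (j + 1)) \<le> 2 * real (Suc n)"
      using j(1) by (simp flip: of_nat_le_iff[where 'a = real])
    then have "1 / 2 * (1 / real (Suc n)) \<le> 1 / real (2 ^ (j + 1))"
      by (simp add: field_simps)
    also have "\<dots> = cmod (b (2 ^ (j + 1))) powr p"
    proof -
      have "cmod (b (2 ^ (j + 1))) = real (2 ^ (j + 1)) powr - (1 / p)"
        by (simp add: b_def pow2_def image_iff del: power_Suc)
      then show ?thesis
        using assms by (simp only: powr_powr) (simp add: powr_minus_divide)
    qed
    finally show "\<exists>k\<ge>n. 1 / 2 * (1 / real (Suc n)) \<le> cmod (b k) powr p"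
      using j(2) by (intro exI[of _ "2 ^ (j + 1)"]) auto
  qed auto
  ultimately show ?thesis
    by blast
qed

theorem corollary4p3:
  fixes p :: real
  assumes "1 < p"
  shows "multipliers (dp_space p) \<subset> dp_space p \<and> multipliers (dp_space p) \<noteq> ell1"
  using multipliers_subset_dp_space[of p] dp_space_not_subset_multipliers[OF assms]
    ell1_not_subset_dp_space[of p] assms
  by auto

end
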